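(* Up to isomorphism there are exactly 18 prime graphs $G$ with $\deg(G)=4$: the 12 split graphs $$D_{4,1},\ \overline{D_{4,1}},\ D_{2,2},\ \overline{D_{2,2}},\ R_{311},\ \overline{R_{311}},\ R_{331},\ \overline{R_{331}},\ R_{211},\ \overline{R_{211}},\ R_{321},\ \overline{R_{321}},$$ together with the 6 non-split graphs $$B_1,\ \overline{B_1},\ B_2,\ \overline{B_2},\ B_3,\ \overline{B_3}.$$
   Context: Graphs are finite and simple, with nonempty vertex set; $\overline{G}$ is the complement of $G$. A 2-switch on $G$: given four distinct vertices $a,b,x,y$ with $ab,xy\in E(G)$ and $ax,by\notin E(G)$, delete the edges $ab,xy$ and add the edges $ax,by$ (two 2-switches are equal iff they delete the same two edges and add the same two edges). The 2-switch-degree $\deg(G)$ is the number of distinct 2-switches that can be performed on $G$. A vertex is active in $G$ if it is one of the four vertices involved in some 2-switch on $G$; $G$ is active if all its vertices are active. A split graph is a graph whose vertex set can be partitioned into a clique $K$ and an independent set $I$ (either possibly empty); when such a bipartition is fixed one writes $(S,K,I)$. If $(S,K,I)$ is split and $G$ is a graph vertex-disjoint from $S$, the Tyshkevich composition $(S,K,I)\circ G$ has vertex set $V(S)\cup V(G)$ and edge set $E(S)\cup E(G)\cup\{xy: x\in K,\ y\in V(G)\}$. A graph $G$ is decomposable if $G=S\circ H$ for some $S,H$ with $|S|,|H|\ge1$, and indecomposable otherwise. A graph is prime if it is indecomposable and active. The named split graphs (given by clique $K$, independent set $I$, and neighborhoods of the vertices of $I$): - $D_{4,1}$: $K=\{1,2,3,4,5\}$,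 $I=\{a,b\}$, $N_a=\{1\}$, $N_b=\{2,3,4,5\}$. - $D_{2,2}$: $K=\{1,2,3,4\}$, $I=\{a,b\}$, $N_a=\{1,2\}$, $N_b=\{3,4\}$. - $R_{311}$: $K=\{1,2,3,4\}$, $I=\{a,b,c\}$, $N_a=\{1\}$, $N_b=\{2\}$, $N_c=\{1,3,4\}$. - $R_{331}$: $K=\{1,2,3,4\}$, $I=\{a,b,c\}$, $N_a=\{1\}$, $N_b=\{2,3,4\}$, $N_c=\{1,3,4\}$. - $R_{321}$: $K=\{1,2,3,4\}$, $I=\{a,b,c\}$, $N_a=\{1\}$, $N_b=\{2,3\}$, $N_c=\{1,3,4\}$. - $R_{211}$: $K=\{1,2,3\}$, $I=\{a,b,c\}$, $N_a=N_c=\{1\}$, $N_b=\{2,3\}$. For $j\in\{1,2,3\}$, $B_j$ is the graph with vertex set $\{v,c_0,c_1,c_2,c_3\}$ in which $c_0c_1c_2c_3c_0$ is an induced 4-cycle and the neighborhood of $v$ is $\{c_0,\dots,c_{j-1}\}$. *)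

theory Defs
  imports Main
begin

type_synonym 'a graph = "'a set \<times> 'a set set"

abbreviation verts :: "'a graph \<Rightarrow> 'a set" where "verts \<equiv> fst"
abbreviation edges :: "'a graph \<Rightarrow> 'a set set" where "edges \<equiv> snd"

definition is_graph :: "'a graph \<Rightarrow> bool" where
  "is_graph G \<longleftrightarrow> finite (verts G) \<and> verts G \<noteq> {} \<and>
     edges G \<subseteq> {e. e \<subseteq> verts G \<and> card e = 2}"

definition complement :: "'a graph \<Rightarrow> 'a graph" where
  "complement G = (verts G, {{u, v} | u v. u \<in> verts G \<and> v \<in> verts G \<and> u \<noteq> v \<and> {u, v} \<notin> edges G})"

definition isomorphic :: "'a graph \<Rightarrow> 'b graph \<Rightarrow> bool" where
  "isomorphic G H \<longleftrightarrow> (\<exists>f. bij_betw f (verts G) (verts H) \<and>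
     (\<forall>u\<in>verts G. \<forall>v\<in>verts G. {u, v} \<in> edges G \<longleftrightarrow> {f u, f v} \<in> edges H))"

definition switchable :: "'a graph \<Rightarrow> 'a \<Rightarrow> 'a \<Rightarrow> 'a \<Rightarrow> 'a \<Rightarrow> bool" where
  "switchable G a b x y \<longleftrightarrow> {a, b, x, y} \<subseteq> verts G \<and> distinct [a, b, x, y] \<and>
     {a, b} \<in> edges G \<and> {x, y} \<in> edges G \<and> {a, x} \<notin> edges G \<and> {b, y} \<notin> edges G"

text \<open>
  Pairs (set of deleted edges, set of added edges), so that the different quadruples
  describing the same 2-switch are counted once.
\<close>

definition two_switches :: "'a graph \<Rightarrow> ('a set set \<times> 'a set set) set" where
  "two_switches G = {({{a, b}, {x, y}}, {{a, x}, {b, y}}) | a b x y. switchable G a b x y}"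

definition switch_degree :: "'a graph \<Rightarrow> nat" where
  "switch_degree G = card (two_switches G)"

definition active_vertex :: "'a graph \<Rightarrow> 'a \<Rightarrow> bool" where
  "active_vertex G v \<longleftrightarrow> (\<exists>a b x y. switchable G a b x y \<and> v \<in> {a, b, x, y})"

definition active :: "'a graph \<Rightarrow> bool" where
  "active G \<longleftrightarrow> (\<forall>v\<in>verts G. active_vertex G v)"

definition split_partition :: "'a graph \<Rightarrow> 'a set \<Rightarrow> 'a set \<Rightarrow> bool" where
  "split_partition S K I \<longleftrightarrow> verts S = K \<union> I \<and> K \<inter> I = {} \<and>
     (\<forall>u\<in>K. \<forall>v\<in>K. u \<noteq> v \<longrightarrow> {u, v} \<in> edges S) \<and>
     (\<forall>u\<in>I. \<forall>v\<in>I. {u, v} \<notin> edges S)"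

definition split_graph :: "'a graph \<Rightarrow> bool" where
  "split_graph S \<longleftrightarrow> (\<exists>K I. split_partition S K I)"

definition compose :: "'a graph \<times> 'a set \<times> 'a set \<Rightarrow> 'a graph \<Rightarrow> 'a graph" where
  "compose = (\<lambda>(S, K, I) G. (verts S \<union> verts G,
     edges S \<union> edges G \<union> {{x, y} | x y. x \<in> K \<and> y \<in> verts G}))"

text \<open>Both factors are nonempty because \<^const>\<open>is_graph\<close> requires it.\<close>

definition decomposable :: "'a graph \<Rightarrow> bool" where
  "decomposable G \<longleftrightarrow> (\<exists>S K I H. is_graph S \<and> is_graph H \<and> split_partition S K I \<and>
     verts S \<inter> verts H = {} \<and> G = compose (S, K, I) H)"

definition prime_graph :: "'a graph \<Rightarrow> bool" where
  "prime_graph G \<longleftrightarrow> \<not> decomposable G \<and> active G"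

text \<open>
  In the named split graphs the vertices $a$, $b$, $c$ of the independent set are encoded as 6, 7, 8.
\<close>

definition split_of :: "'a set \<Rightarrow> 'a set \<Rightarrow> ('a \<Rightarrow> 'a set) \<Rightarrow> 'a graph" where
  "split_of K I N = (K \<union> I,
     {{u, v} | u v. u \<in> K \<and> v \<in> K \<and> u \<noteq> v} \<union> {{i, k} | i k. i \<in> I \<and> k \<in> N i})"

definition D41 :: "nat graph" where
  "D41 = split_of {1, 2, 3, 4, 5} {6, 7} ((\<lambda>_. {})(6 := {1}, 7 := {2, 3, 4, 5}))"

definition D22 :: "nat graph" where
  "D22 = split_of {1, 2, 3, 4} {6, 7} ((\<lambda>_. {})(6 := {1, 2}, 7 := {3, 4}))"

definition R311 :: "nat graph" where
  "R311 = split_of {1, 2, 3, 4} {6, 7, 8} ((\<lambda>_. {})(6 := {1}, 7 := {2}, 8 := {1, 3, 4}))"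

definition R331 :: "nat graph" where
  "R331 = split_of {1, 2, 3, 4} {6, 7, 8} ((\<lambda>_. {})(6 := {1}, 7 := {2, 3, 4}, 8 := {1, 3, 4}))"

definition R321 :: "nat graph" where
  "R321 = split_of {1, 2, 3, 4} {6, 7, 8} ((\<lambda>_. {})(6 := {1}, 7 := {2, 3}, 8 := {1, 3, 4}))"

definition R211 :: "nat graph" where
  "R211 = split_of {1, 2, 3} {6, 7, 8} ((\<lambda>_. {})(6 := {1}, 7 := {2, 3}, 8 := {1}))"

text \<open>In \<open>Bj j\<close> the vertex $c_i$ is encoded as \<open>i\<close>, and the vertex $v$ as 4.\<close>

definition Bj :: "nat \<Rightarrow> nat graph" where
  "Bj j = ({0, 1, 2, 3, 4}, {{0, 1}, {1, 2}, {2, 3}, {3, 0}} \<union> {{4, i} | i. i < j})"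

definition split_list :: "nat graph list" where
  "split_list = [D41, complement D41, D22, complement D22, R311, complement R311,
     R331, complement R331, R211, complement R211, R321, complement R321]"

definition nonsplit_list :: "nat graph list" where
  "nonsplit_list = [Bj 1, complement (Bj 1), Bj 2, complement (Bj 2), Bj 3, complement (Bj 3)]"

end

theory Submission
  imports Defs
begin

text \<open>
  Two distinct perfect matchings on four vertices, one inside the graph and one inside its
  complement, make a 2-switch, and an induced $P_4$, $C_4$ or $2K_2$ carries one, two or two of
  them.  A prime graph of degree 4 is covered by its four 2-switches, and the proof shows that it
  can be built up from a single alternating 4-cycle by a search that stays small.

  The search rests on \<open>growth\<close>.  Let \<open>W\<close> be a proper nonempty subset of the vertices of an
  indecomposable graph \<open>G\<close>.  Call a vertex outside \<open>W\<close> homogeneous if it sees all of \<open>W\<close>, none of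
  \<open>W\<close>, or exactly the clique of a fixed split partition of \<open>W\<close>.  If all outer vertices are
  homogeneous and any two of them are related as they are in a Tyshkevich composition, then \<open>G\<close>
  is such a composition.  So \<open>W\<close> can always be enlarged by one vertex that is not homogeneous or by
  a pair of homogeneous vertices with the wrong relation between them.  For the sets that occur
  here, each such enlargement raises the number of 2-switches inside \<open>W\<close>, so that after at most three
  steps this number is 4 or too large.  Once it is 4, all 2-switches of \<open>G\<close> lie inside \<open>W\<close>, and
  \<open>W\<close> is the whole vertex set because \<open>G\<close> is active.

  This turns the classification into a finite tree: its roots are the three types of
  alternating 4-cycles, a node is dropped when its degree exceeds 4, and each leaf of degree 4 must be
  one of the eighteen graphs.  To have the tree evaluated by rewriting, a list of vertices is
  represented by its \<open>code\<close>, one triangle of the adjacency matrix, and degree, split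
  partitions, and isomorphism are read off from codes (\<open>deg_code\<close>, \<open>splits_code\<close>, \<open>same_graph_iff\<close>).

  The same computations settle the properties of the eighteen graphs.  They are prime because no
  2-switch crosses the two parts of a Tyshkevich composition (\<open>cut_not_crossed\<close>), whereas every
  nontrivial bipartition of their vertices is crossed by a 2-switch; this also makes them active.
\<close>

section \<open>Codes of ordered graphs\<close>

text \<open>
  The newest vertex comes first, and its row lists its adjacencies to the older vertices only, so that
  adding a vertex to a list prefixes one row to the code.
\<close>

type_synonym code = "bool list list"

definition adj :: "'a graph \<Rightarrow> 'a \<Rightarrow> 'a \<Rightarrow> bool" where
  "adj G u v \<longleftrightarrow> {u, v} \<in> edges G"

fun code :: "('a \<Rightarrow> 'a \<Rightarrow> bool) \<Rightarrow> 'a list \<Rightarrow> code" where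
  "code E [] = []"
| "code E (v # vs) = map (E v) vs # code E vs"

lemma adj_sym: "adj G u v = adj G v u"
  by (simp add: adj_def insert_commute)

lemma adj_irrefl: "is_graph G \<Longrightarrow> \<not> adj G v v"
  by (auto simp: adj_def is_graph_def)

lemma adj_verts: "is_graph G \<Longrightarrow> adj G u v \<Longrightarrow> u \<in> verts G \<and> v \<in> verts G"
  by (auto simp: adj_def is_graph_def)

lemma vertex_order:
  assumes "is_graph G"
  obtains ws where "distinct ws" "set ws = verts G"
  using assms finite_distinct_list[of "verts G"] by (auto simp: is_graph_def)

lemma length_code [simp]: "length (code E vs) = length vs"
  by (induction vs) auto

lemma code_append:
  "\<exists>pre. code E (xs @ ys) = pre @ code E ys \<and> length pre = length xs"
proof (induction xs)
  case (Cons x xs)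
  then obtain pre where "code E (xs @ ys) = pre @ code E ys" "length pre = length xs" by blast
  then show ?case by (intro exI[of _ "map (E x) (xs @ ys) # pre"]) simp
qed simp

lemma code_map: "code E (map f zs) = code (\<lambda>i j. E (f i) (f j)) zs"
  by (induction zs) auto

lemma code_cong:
  "(\<And>u v. u \<in> set zs \<Longrightarrow> v \<in> set zs \<Longrightarrow> E u v = E' u v) \<Longrightarrow> code E zs = code E' zs"
  by (induction zs) auto

text \<open>
  The whole square matrix of a code. The entry \<open>d\<close> on the diagonal decides whether a vertex
  counts as adjacent to itself: with \<open>True\<close>, a false entry means a nonadjacent pair of
  \<^emph>\<open>distinct\<close> vertices.
\<close>

fun full :: "bool \<Rightarrow> code \<Rightarrow> code" where
  "full d [] = []"
| "full d (r # rs) = (d # r) # map2 (#) r (full d rs)"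

lemma full_code:
  assumes "distinct vs" "\<And>u v. E u v = E v u"
  shows "full d (code E vs) = map (\<lambda>u. map (\<lambda>w. if u = w then d else E u w) vs) vs"
  using assms(1)
proof (induction vs)
  case (Cons v vs)
  have "full d (code E (v # vs)) =
      (d # map (E v) vs) # map2 (#) (map (E v) vs) (map (\<lambda>u. map (\<lambda>w. if u = w then d else E u w) vs) vs)"
    using Cons by simp
  also have "map2 (#) (map (E v) vs) (map (\<lambda>u. map (\<lambda>w. if u = w then d else E u w) vs) vs)
      = map (\<lambda>u. E v u # map (\<lambda>w. if u = w then d else E u w) vs) vs"
    by (simp add: zip_map_map zip_same_conv_map)
  finally show ?case
    using Cons.prems assms(2) by auto
qed simp

lemma full_False_code:
  assumes "is_graph G" "distinct vs"
  shows "full False (code (adj G) vs) = map (\<lambda>u. map (adj G u) vs) vs"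
proof -
  have "(if u = w then False else adj G u w) = adj G u w" for u w
    using adj_irrefl[OF assms(1)] by auto
  then show ?thesis
    using full_code[of vs "adj G" False] assms(2) adj_sym[of G] by auto
qed

section \<open>Counting 2-switches\<close>

text \<open>
  The entry for \<open>b\<close> and \<open>x\<close> is the number of vertices \<open>y\<close> that complete a new vertex \<open>v\<close> with
  \<open>v b\<close> adjacent and \<open>v x\<close> nonadjacent to a 2-switch. It does not depend on \<open>v\<close>, so one matrix
  serves all the vertices that may be added to the same graph.
\<close>

definition completions :: "code \<Rightarrow> nat list list" where
  "completions c = map (\<lambda>p. map (\<lambda>q. length (filter (\<lambda>(i, j). \<not> i \<and> j) (zip p q))) (full False c)) (full True c)"

definition gain :: "bool list \<Rightarrow> nat list list \<Rightarrow> nat" where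
  "gain r t = (\<Sum>(i, ks) \<leftarrow> zip r t. if i then \<Sum>(j, k) \<leftarrow> zip r ks. if j then 0 else k else 0)"

fun deg :: "code \<Rightarrow> nat" where
  "deg [] = 0"
| "deg (r # c) = gain r (completions c) + deg c"

lemma completions_code:
  assumes "distinct vs" "\<And>u v. E u v = E v u" "\<And>v. \<not> E v v"
  shows "completions (code E vs) =
    map (\<lambda>b. map (\<lambda>x. card {y \<in> set vs. y \<noteq> b \<and> \<not> E b y \<and> E x y}) vs) vs"
proof -
  have *: "length (filter (\<lambda>(i, j). \<not> i \<and> j)
      (zip (map (\<lambda>w. if b = w then True else E b w) vs) (map (\<lambda>w. if x = w then False else E x w) vs)))
    = card {y \<in> set vs. y \<noteq> b \<and> \<not> E b y \<and> E x y}" (is "?l = _") for b x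
  proof -
    have "?l = length (filter (\<lambda>y. y \<noteq> b \<and> \<not> E b y \<and> E x y) vs)"
      using assms(3) by (auto simp: zip_map_map zip_same_conv_map filter_map o_def intro!: arg_cong[where f=length] filter_cong)
    also have "\<dots> = card {y \<in> set vs. y \<noteq> b \<and> \<not> E b y \<and> E x y}"
      using assms(1) by (metis distinct_card distinct_filter set_filter)
    finally show ?thesis .
  qed
  show ?thesis
    unfolding completions_def full_code[where E=E, OF assms(1,2)] map_map o_def * ..
qed

text \<open>
  The 2-switches through \<open>v\<close>: deleting \<open>v b\<close> and \<open>x y\<close>, adding \<open>v x\<close> and \<open>b y\<close>.
\<close>

definition switch_triples :: "('a \<Rightarrow> 'a \<Rightarrow> bool) \<Rightarrow> 'a \<Rightarrow> 'a set \<Rightarrow> ('a \<times> 'a \<times> 'a) set" where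
  "switch_triples E v S = {(b, x, y). b \<in> S \<and> x \<in> S \<and> y \<in> S \<and> E v b \<and> \<not> E v x \<and> y \<noteq> b \<and> \<not> E b y \<and> E x y}"

lemma gain_code:
  assumes "distinct vs" "\<And>u v. E u v = E v u" "\<And>v. \<not> E v v"
  shows "gain (map (E v) vs) (completions (code E vs)) = card (switch_triples E v (set vs))"
proof -
  let ?f = "\<lambda>b x. card {y \<in> set vs. y \<noteq> b \<and> \<not> E b y \<and> E x y}"
  have "gain (map (E v) vs) (completions (code E vs)) =
    (\<Sum>b\<leftarrow>vs. if E v b then \<Sum>x\<leftarrow>vs. if E v x then 0 else ?f b x else 0)"
    unfolding gain_def completions_code[where E=E, OF assms] map2_map_map by simp
  also have "\<dots> = (\<Sum>b\<in>set vs. if E v b then \<Sum>x\<in>set vs. if E v x then 0 else ?f b x else 0)"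
    unfolding sum_list_distinct_conv_sum_set[OF assms(1)] ..
  also have "\<dots> = (\<Sum>b\<in>{b\<in>set vs. E v b}. \<Sum>x\<in>{x\<in>set vs. \<not> E v x}. ?f b x)"
    unfolding sum.inter_filter[OF finite_set] by (auto intro!: sum.cong)
  also have "\<dots> = card (SIGMA b:{b\<in>set vs. E v b}. SIGMA x:{x\<in>set vs. \<not> E v x}.
      {y \<in> set vs. y \<noteq> b \<and> \<not> E b y \<and> E x y})"
    by simp
  also have "(SIGMA b:{b\<in>set vs. E v b}. SIGMA x:{x\<in>set vs. \<not> E v x}.
      {y \<in> set vs. y \<noteq> b \<and> \<not> E b y \<and> E x y}) = switch_triples E v (set vs)"
    by (auto simp: switch_triples_def)
  finally show ?thesis .
qed

definition switches_in :: "'a graph \<Rightarrow> 'a set \<Rightarrow> ('a set set \<times> 'a set set) set" where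
  "switches_in G S = {({{a, b}, {x, y}}, {{a, x}, {b, y}}) | a b x y.
     switchable G a b x y \<and> {a, b, x, y} \<subseteq> S}"

lemma switches_in_support:
  assumes "s \<in> switches_in G S"
  shows "\<Union>(fst s) \<subseteq> S"
proof -
  obtain a b x y where "s = ({{a, b}, {x, y}}, {{a, x}, {b, y}})" "{a, b, x, y} \<subseteq> S"
    using assms by (auto simp: switches_in_def)
  then show ?thesis by simp
qed

lemma switches_in_mono:
  assumes "S \<subseteq> T"
  shows "switches_in G S \<subseteq> switches_in G T"
proof
  fix s assume "s \<in> switches_in G S"
  then obtain a b x y where "s = ({{a, b}, {x, y}}, {{a, x}, {b, y}})"
    "switchable G a b x y" "{a, b, x, y} \<subseteq> S"
    by (auto simp: switches_in_def)
  then show "s \<in> switches_in G T"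
    using assms unfolding switches_in_def by blast
qed

text \<open>
  These symmetries allow any of the four vertices to be named first.
\<close>

lemma switchable_sym:
  assumes "switchable G a b x y"
  shows "switchable G b a y x" "switchable G x y a b" "switchable G y x b a"
  using assms by (auto simp: switchable_def insert_commute)

text \<open>
  A 2-switch through \<open>v\<close> is determined by the partners \<open>b\<close> and \<open>x\<close> of \<open>v\<close> in the deleted and in
  the added edges, and by the fourth vertex \<open>y\<close>; every 2-switch through \<open>v\<close> can be written with
  \<open>v\<close> in first place.
\<close>

lemma switches_in_insert:
  assumes "v \<in> verts G" "v \<notin> S" "S \<subseteq> verts G" "is_graph G"
  shows "switches_in G (insert v S) = switches_in G S \<union>
    (\<lambda>(b, x, y). ({{v, b}, {x, y}}, {{v, x}, {b, y}})) ` switch_triples (adj G) v S" (is "?l = ?r \<union> ?i")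
proof
  show "?l \<subseteq> ?r \<union> ?i"
  proof
    fix s assume "s \<in> ?l"
    then obtain a b x y where s: "s = ({{a, b}, {x, y}}, {{a, x}, {b, y}})"
      and sw: "switchable G a b x y" and sub: "{a, b, x, y} \<subseteq> insert v S"
      by (auto simp: switches_in_def)
    have key: "s \<in> ?i" if "s = ({{v, b}, {x, y}}, {{v, x}, {b, y}})" "switchable G v b x y"
      "{b, x, y} \<subseteq> insert v S" for b x y
    proof -
      have "(b, x, y) \<in> switch_triples (adj G) v S"
        using that(2,3) by (auto simp: switch_triples_def switchable_def adj_def)
      then show ?thesis
        using that(1) by (intro image_eqI[where x="(b, x, y)"]) auto
    qed
    consider "v \<notin> {a, b, x, y}" | "v = a" | "v = b" | "v = x" | "v = y" by auto
    then show "s \<in> ?r \<union> ?i"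
    proof cases
      case 1 then show ?thesis using s sw sub by (auto simp: switches_in_def)
    next
      case 2
      show ?thesis
      proof (rule UnI2, rule key)
        show "s = ({{v, b}, {x, y}}, {{v, x}, {b, y}})" unfolding s 2 by (simp add: insert_commute)
        show "switchable G v b x y" unfolding 2 by (rule sw)
        show "{b, x, y} \<subseteq> insert v S" using sub by auto
      qed
    next
      case 3
      show ?thesis
      proof (rule UnI2, rule key)
        show "s = ({{v, a}, {y, x}}, {{v, y}, {a, x}})" unfolding s 3 by (simp add: insert_commute)
        show "switchable G v a y x" unfolding 3 by (rule switchable_sym(1)[OF sw])
        show "{a, y, x} \<subseteq> insert v S" using sub by auto
      qed
    next
      case 4
      show ?thesis
      proof (rule UnI2, rule key)
        show "s = ({{v, y}, {a, b}}, {{v, a}, {y, b}})" unfolding s 4 by (simp add: insert_commute)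
        show "switchable G v y a b" unfolding 4 by (rule switchable_sym(2)[OF sw])
        show "{y, a, b} \<subseteq> insert v S" using sub by auto
      qed
    next
      case 5
      show ?thesis
      proof (rule UnI2, rule key)
        show "s = ({{v, x}, {b, a}}, {{v, b}, {x, a}})" unfolding s 5 by (simp add: insert_commute)
        show "switchable G v x b a" unfolding 5 by (rule switchable_sym(3)[OF sw])
        show "{x, b, a} \<subseteq> insert v S" using sub by auto
      qed
    qed
  qed
  show "?r \<union> ?i \<subseteq> ?l"
  proof -
    have "?r \<subseteq> ?l" by (rule switches_in_mono) auto
    moreover have "?i \<subseteq> ?l"
    proof
      fix s assume "s \<in> ?i"
      then obtain b x y where s: "s = ({{v, b}, {x, y}}, {{v, x}, {b, y}})" and p: "(b, x, y) \<in> switch_triples (adj G) v S"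
        by auto
      have "switchable G v b x y"
        using p assms adj_irrefl[OF assms(4)] by (auto simp: switch_triples_def switchable_def adj_def)
      moreover have "{v, b, x, y} \<subseteq> insert v S" using p by (auto simp: switch_triples_def)
      ultimately show "s \<in> ?l" using s unfolding switches_in_def by blast
    qed
    ultimately show ?thesis by blast
  qed
qed

text \<open>
  Adding a vertex keeps the 2-switches that avoid it, and \<open>switches_in_insert\<close> parametrises the
  new ones injectively.
\<close>

lemma deg_code:
  assumes "is_graph G" "distinct vs" "set vs \<subseteq> verts G"
  shows "deg (code (adj G) vs) = card (switches_in G (set vs)) \<and> finite (switches_in G (set vs))"
  using assms(2,3)
proof (induction vs)
  case Nil
  then show ?case by (auto simp: switches_in_def)
next
  case (Cons v vs)
  let ?f = "\<lambda>(b, x, y). ({{v, b}, {x, y}}, {{v, x}, {b, y}})"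
  let ?P = "switch_triples (adj G) v (set vs)"
  have fin: "finite ?P"
    by (rule finite_subset[of _ "set vs \<times> set vs \<times> set vs"]) (auto simp: switch_triples_def)
  have inj: "inj_on ?f ?P"
  proof (rule inj_onI)
    fix p p' assume p: "p \<in> ?P" "p' \<in> ?P" and eq: "?f p = ?f p'"
    obtain b x y b' x' y' where pp: "p = (b, x, y)" "p' = (b', x', y')"
      by (metis prod_cases3)
    have v: "v \<notin> {b, x, y, b', x', y'}"
      using p Cons.prems by (auto simp: pp switch_triples_def)
    have "{{v, b}, {x, y}} = {{v, b'}, {x', y'}}" "{{v, x}, {b, y}} = {{v, x'}, {b', y'}}"
      using eq by (simp_all add: pp)
    then have "b = b'" "x = x'" "{x, y} = {x', y'}"
      using v by (auto simp: doubleton_eq_iff)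
    then show "p = p'" by (auto simp: pp doubleton_eq_iff)
  qed
  have disj: "switches_in G (set vs) \<inter> ?f ` ?P = {}"
  proof -
    have "v \<notin> \<Union>(fst s)" if "s \<in> switches_in G (set vs)" for s
      using switches_in_support[OF that] Cons.prems by auto
    moreover have "v \<in> \<Union>(fst s)" if "s \<in> ?f ` ?P" for s
      using that by auto
    ultimately show ?thesis by blast
  qed
  have eq: "switches_in G (set (v # vs)) = switches_in G (set vs) \<union> ?f ` ?P"
    using switches_in_insert[of v G "set vs"] Cons.prems assms(1) by simp
  have "gain (map (adj G v) vs) (completions (code (adj G) vs)) = card ?P"
    using Cons.prems gain_code[of vs "adj G" v] adj_sym[of G] adj_irrefl[OF assms(1)] by auto
  then have "deg (code (adj G) (v # vs)) = card (?f ` ?P) + card (switches_in G (set vs))"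
    using Cons card_image[OF inj] by simp
  then show ?case
    unfolding eq using disj fin Cons by (auto simp: card_Un_disjoint)
qed

lemma switches_in_verts: "switches_in G (verts G) = two_switches G"
proof -
  have "switchable G a b x y \<Longrightarrow> {a, b, x, y} \<subseteq> verts G" for a b x y
    by (simp add: switchable_def)
  then show ?thesis unfolding switches_in_def two_switches_def by blast
qed

lemma switch_degree_code:
  assumes "is_graph G" "distinct vs" "set vs = verts G"
  shows "switch_degree G = deg (code (adj G) vs)"
  using deg_code[of G vs] assms by (simp add: switches_in_verts switch_degree_def)

lemma deg_code_le:
  assumes G: "is_graph G" and vs: "distinct vs" "set vs \<subseteq> verts G"
  shows "deg (code (adj G) vs) \<le> switch_degree G"
proof -
  obtain ws where ws: "distinct ws" "set ws = verts G" using vertex_order[OF G] .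
  have "finite (two_switches G)"
    using deg_code[OF G ws(1)] ws(2) by (simp add: switches_in_verts)
  then show ?thesis
    using deg_code[OF G vs] switches_in_mono[OF vs(2), of G]
    by (auto simp: switches_in_verts switch_degree_def intro: card_mono)
qed

text \<open>
  The stopping rule of the search: when the inner 2-switches are all there are, an active graph
  has no room for further vertices.
\<close>

lemma spanning_if_all_switches_inside:
  assumes G: "is_graph G" and act: "active G"
    and vs: "distinct vs" "set vs \<subseteq> verts G" and d: "deg (code (adj G) vs) = switch_degree G"
  shows "set vs = verts G"
proof
  obtain ws where ws: "distinct ws" "set ws = verts G" using vertex_order[OF G] .
  have "finite (two_switches G)"
    using deg_code[OF G ws(1)] ws(2) by (simp add: switches_in_verts)
  moreover have "switches_in G (set vs) \<subseteq> two_switches G"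
    using switches_in_mono[OF vs(2), of G] by (simp add: switches_in_verts)
  ultimately have eq: "switches_in G (set vs) = two_switches G"
    using deg_code[OF G vs] d by (intro card_subset_eq) (auto simp: switch_degree_def)
  show "verts G \<subseteq> set vs"
  proof
    fix v assume "v \<in> verts G"
    then obtain a b x y where sw: "switchable G a b x y" and v: "v \<in> {a, b, x, y}"
      using act by (auto simp: active_def active_vertex_def)
    let ?s = "({{a, b}, {x, y}}, {{a, x}, {b, y}})"
    have "?s \<in> switches_in G (set vs)"
      unfolding eq two_switches_def using sw by blast
    then have "\<Union>(fst ?s) \<subseteq> set vs" by (rule switches_in_support)
    then show "v \<in> set vs" using v by auto
  qed
qed (rule vs(2))

section \<open>Split partitions and decompositions\<close>

definition split_on :: "('a \<Rightarrow> 'a \<Rightarrow> bool) \<Rightarrow> 'a set \<Rightarrow> 'a set \<Rightarrow> bool" where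
  "split_on E S K \<longleftrightarrow> K \<subseteq> S \<and> (\<forall>u\<in>K. \<forall>v\<in>K. u \<noteq> v \<longrightarrow> E u v) \<and>
     (\<forall>u\<in>S - K. \<forall>v\<in>S - K. \<not> E u v)"

text \<open>
  A new vertex may join the clique if it sees the whole of it, and the independent set if it
  sees nothing of that. Each list in the result is the indicator of a clique side.
\<close>

fun splits :: "code \<Rightarrow> bool list list" where
  "splits [] = [[]]"
| "splits (r # c) = concat (map (\<lambda>m.
     (if list_all2 (\<longrightarrow>) m r then [True # m] else []) @
     (if list_all2 (\<longrightarrow>) r m then [False # m] else [])) (splits c))"

lemma splits_code:
  assumes "distinct vs" "\<And>u v. E u v = E v u" "\<And>v. \<not> E v v"
  shows "m \<in> set (splits (code E vs)) \<longleftrightarrow> (\<exists>K. m = map (\<lambda>v. v \<in> K) vs \<and> split_on E (set vs) K)"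
  using assms(1)
proof (induction vs arbitrary: m)
  case Nil
  then show ?case by (auto simp: split_on_def)
next
  case (Cons v vs)
  have v: "v \<notin> set vs" and d: "distinct vs" using Cons.prems by auto
  have imp: "list_all2 (\<longrightarrow>) (map P vs) (map Q vs) \<longleftrightarrow> (\<forall>u\<in>set vs. P u \<longrightarrow> Q u)" for P Q
    by (simp add: list_all2_map1 list_all2_map2 list_all2_same)
  have ins: "map (\<lambda>u. u \<in> insert v K) vs = map (\<lambda>u. u \<in> K) vs" for K
    using v by auto
  have rem: "map (\<lambda>u. u \<in> K - {v}) vs = map (\<lambda>u. u \<in> K) vs" for K
    using v by auto
  let ?Q = "\<lambda>K. split_on E (set vs) K \<and>
      (((\<forall>u\<in>set vs. u \<in> K \<longrightarrow> E v u) \<and> m = True # map (\<lambda>u. u \<in> K) vs) \<or>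
       ((\<forall>u\<in>set vs. E v u \<longrightarrow> u \<in> K) \<and> m = False # map (\<lambda>u. u \<in> K) vs))"
  have "m \<in> set (splits (code E (v # vs))) \<longleftrightarrow> (\<exists>K. ?Q K)"
    (is "?l \<longleftrightarrow> ?r")
  proof
    assume ?l
    then obtain m' where m': "m' \<in> set (splits (code E vs))"
      "(list_all2 (\<longrightarrow>) m' (map (E v) vs) \<and> m = True # m') \<or>
       (list_all2 (\<longrightarrow>) (map (E v) vs) m' \<and> m = False # m')"
      by (auto split: if_splits)
    then obtain K where K: "m' = map (\<lambda>u. u \<in> K) vs" "split_on E (set vs) K"
      using Cons.IH[OF d] by blast
    have "?Q K" using m'(2) K(2) unfolding K(1) imp by blast
    then show ?r ..
  next
    assume ?r
    then obtain K where Q: "?Q K" ..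
    note K = conjunct1[OF Q] and or = conjunct2[OF Q]
    have "map (\<lambda>u. u \<in> K) vs \<in> set (splits (code E vs))" using K Cons.IH[OF d] by blast
    then show ?l using or by (auto simp: imp intro!: bexI[of _ "map (\<lambda>u. u \<in> K) vs"])
  qed
  also have "\<dots> \<longleftrightarrow> (\<exists>K. m = map (\<lambda>u. u \<in> K) (v # vs) \<and> split_on E (set (v # vs)) K)"
  proof
    assume "\<exists>K. ?Q K"
    then obtain K where Q: "?Q K" ..
    note K = conjunct1[OF Q] and or = conjunct2[OF Q]
    from or show "\<exists>K. m = map (\<lambda>u. u \<in> K) (v # vs) \<and> split_on E (set (v # vs)) K"
    proof
      assume *: "(\<forall>u\<in>set vs. u \<in> K \<longrightarrow> E v u) \<and> m = True # map (\<lambda>u. u \<in> K) vs"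
      have "split_on E (set (v # vs)) (insert v K)"
      proof -
        have "E v u \<and> E u v" if "u \<in> K" for u
          using K * that assms(2)[of u v] by (auto simp: split_on_def)
        then show ?thesis using K v by (auto simp: split_on_def)
      qed
      moreover have "m = map (\<lambda>u. u \<in> insert v K) (v # vs)" using * ins by simp
      ultimately show ?thesis by blast
    next
      assume *: "(\<forall>u\<in>set vs. E v u \<longrightarrow> u \<in> K) \<and> m = False # map (\<lambda>u. u \<in> K) vs"
      have vK: "v \<notin> K" using K v by (auto simp: split_on_def)
      have "split_on E (set (v # vs)) K"
      proof -
        have "\<not> E v u \<and> \<not> E u v" if "u \<in> set vs - K" for u
          using * that assms(2)[of u v] by auto
        then show ?thesis using K vK assms(3)[of v] by (auto simp: split_on_def)
      qed
      moreover have "m = map (\<lambda>u. u \<in> K) (v # vs)" using * vK by simp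
      ultimately show ?thesis by blast
    qed
  next
    assume "\<exists>K. m = map (\<lambda>u. u \<in> K) (v # vs) \<and> split_on E (set (v # vs)) K"
    then obtain K where m: "m = map (\<lambda>u. u \<in> K) (v # vs)" and K: "split_on E (set (v # vs)) K" by blast
    have "split_on E (set vs) (K - {v})" using K v by (auto simp: split_on_def)
    moreover have "m = (v \<in> K) # map (\<lambda>u. u \<in> K - {v}) vs" using m rem by simp
    moreover have "v \<in> K \<Longrightarrow> \<forall>u\<in>set vs. u \<in> K - {v} \<longrightarrow> E v u"
      using K by (auto simp: split_on_def)
    moreover have "v \<notin> K \<Longrightarrow> \<forall>u\<in>set vs. E v u \<longrightarrow> u \<in> K - {v}"
      using K v by (auto simp: split_on_def)
    ultimately show "\<exists>K. ?Q K"
      by (cases "v \<in> K") blast+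
  qed
  finally show ?case .
qed

lemma split_graph_code:
  assumes G: "is_graph G" and ws: "distinct ws" "set ws = verts G"
  shows "split_graph G \<longleftrightarrow> splits (code (adj G) ws) \<noteq> []"
proof -
  have "split_graph G \<longleftrightarrow> (\<exists>K. split_on (adj G) (verts G) K)"
  proof
    assume "split_graph G"
    then obtain K I where "split_partition G K I" by (auto simp: split_graph_def)
    moreover from this have "verts G - K = I" by (auto simp: split_partition_def)
    ultimately have "split_on (adj G) (verts G) K"
      by (auto simp: split_partition_def split_on_def adj_def)
    then show "\<exists>K. split_on (adj G) (verts G) K" ..
  next
    assume "\<exists>K. split_on (adj G) (verts G) K"
    then obtain K where "split_on (adj G) (verts G) K" ..
    then have "split_partition G K (verts G - K)"
      by (auto simp: split_partition_def split_on_def adj_def)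
    then show "split_graph G" by (auto simp: split_graph_def)
  qed
  also have "\<dots> \<longleftrightarrow> (\<exists>m. m \<in> set (splits (code (adj G) ws)))"
    using splits_code[of ws "adj G"] ws adj_sym[of G] adj_irrefl[OF G] by auto
  also have "\<dots> \<longleftrightarrow> splits (code (adj G) ws) \<noteq> []"
    by (metis empty_iff empty_set ex_in_conv set_empty)
  finally show ?thesis .
qed

text \<open>
  The condition that \<open>G\<close> is the composition of its induced subgraphs on \<open>S\<close> and \<open>T\<close>, where \<open>S\<close>
  is split with clique side \<open>K\<close>.
\<close>

definition tyshkevich_cut :: "'a graph \<Rightarrow> 'a set \<Rightarrow> 'a set \<Rightarrow> 'a set \<Rightarrow> bool" where
  "tyshkevich_cut G S K T \<longleftrightarrow> S \<union> T = verts G \<and> S \<inter> T = {} \<and> S \<noteq> {} \<and> T \<noteq> {} \<and>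
     split_on (adj G) S K \<and> (\<forall>t\<in>T. \<forall>s\<in>S. adj G s t \<longleftrightarrow> s \<in> K)"

lemma decomposable_iff:
  assumes G: "is_graph G"
  shows "decomposable G \<longleftrightarrow> (\<exists>S K T. tyshkevich_cut G S K T)"
proof
  assume "decomposable G"
  then obtain S K I H where S: "is_graph S" and H: "is_graph H" and p: "split_partition S K I"
    and d: "verts S \<inter> verts H = {}" and G': "G = compose (S, K, I) H"
    unfolding decomposable_def by blast
  have e: "adj G u v \<longleftrightarrow> adj S u v \<or> adj H u v \<or> (u \<in> K \<and> v \<in> verts H) \<or> (v \<in> K \<and> u \<in> verts H)" for u v
    unfolding G' compose_def adj_def by (auto simp: doubleton_eq_iff)
  have KI: "verts S = K \<union> I" "K \<inter> I = {}" using p by (auto simp: split_partition_def)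
  have noH: "\<not> adj H u v" if "u \<in> verts S" for u v using adj_verts[OF H, of u v] that d by auto
  have noS: "\<not> adj S u v" if "v \<in> verts H" for u v using adj_verts[OF S, of u v] that d by auto
  have "split_on (adj G) (verts S) K"
    unfolding split_on_def using p e noH d KI
    by (auto simp: split_partition_def adj_def)
  moreover have "adj G s t \<longleftrightarrow> s \<in> K" if "t \<in> verts H" "s \<in> verts S" for s t
    using that e[of s t] noH noS d KI by auto
  moreover have "verts S \<union> verts H = verts G" by (simp add: G' compose_def)
  ultimately have "tyshkevich_cut G (verts S) K (verts H)"
    using d S H by (simp add: tyshkevich_cut_def is_graph_def)
  then show "\<exists>S K T. tyshkevich_cut G S K T" by blast
next
  assume "\<exists>S K T. tyshkevich_cut G S K T"
  then obtain S K T where V: "S \<union> T = verts G" and d: "S \<inter> T = {}" and ne: "S \<noteq> {}" "T \<noteq> {}"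
    and sp: "split_on (adj G) S K" and ST: "\<And>s t. s \<in> S \<Longrightarrow> t \<in> T \<Longrightarrow> adj G s t \<longleftrightarrow> s \<in> K"
    unfolding tyshkevich_cut_def by blast
  define X where "X = (S, {e \<in> edges G. e \<subseteq> S})"
  define Y where "Y = (T, {e \<in> edges G. e \<subseteq> T})"
  have fin: "finite S" "finite T" using G V by (auto simp: is_graph_def intro: finite_subset)
  have "is_graph X" "is_graph Y" using G fin ne by (auto simp: is_graph_def X_def Y_def)
  moreover have "split_partition X K (S - K)"
    using sp by (auto simp: split_partition_def split_on_def X_def adj_def)
  moreover have "G = compose (X, K, S - K) Y"
  proof (rule prod_eqI)
    show "verts G = verts (compose (X, K, S - K) Y)"
      using V by (simp add: compose_def X_def Y_def)
    have "e \<in> edges G \<longleftrightarrow> e \<in> edges X \<union> edges Y \<union> {{x, y} |x y. x \<in> K \<and> y \<in> T}" for e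
    proof
      assume e: "e \<in> edges G"
      then have "e \<subseteq> verts G" "card e = 2" using G by (auto simp: is_graph_def)
      then obtain p q where pq: "e = {p, q}" "p \<in> S \<union> T" "q \<in> S \<union> T"
        using V by (auto simp: card_2_iff)
      have "adj G p q" "adj G q p" using e pq(1) by (simp_all add: adj_def insert_commute)
      then have "p \<in> S \<Longrightarrow> q \<in> T \<Longrightarrow> p \<in> K" "q \<in> S \<Longrightarrow> p \<in> T \<Longrightarrow> q \<in> K"
        using ST by auto
      then show "e \<in> edges X \<union> edges Y \<union> {{x, y} |x y. x \<in> K \<and> y \<in> T}"
        using pq e by (auto simp: X_def Y_def)
    next
      assume "e \<in> edges X \<union> edges Y \<union> {{x, y} |x y. x \<in> K \<and> y \<in> T}"
      moreover have "{x, y} \<in> edges G" if "x \<in> K" "y \<in> T" for x y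
        using ST[of x y] that sp by (auto simp: adj_def split_on_def)
      ultimately show "e \<in> edges G" by (auto simp: X_def Y_def)
    qed
    then show "edges G = edges (compose (X, K, S - K) Y)"
      by (auto simp: compose_def Y_def)
  qed
  moreover have "verts X \<inter> verts Y = {}" using d by (simp add: X_def Y_def)
  ultimately show "decomposable G" unfolding decomposable_def by blast
qed

section \<open>Growing indecomposable graphs\<close>

text \<open>
  An indecomposable graph with at least two vertices has at most one split partition, so in the
  search the first one found is the only candidate for the middle kind of homogeneous vertices.
\<close>

definition homogeneous_rows :: "code \<Rightarrow> bool list list" where
  "homogeneous_rows c = [replicate (length c) True, replicate (length c) False] @ take 1 (splits c)"

definition new_rows :: "code \<Rightarrow> bool list list" where
  "new_rows c = (let ts = homogeneous_rows c in filter (\<lambda>r. r \<notin> set ts) (List.n_lists (length c) [False, True]))"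

text \<open>
  Pairs of homogeneous vertices whose relation rules out a composition: a vertex seeing
  everything (\<open>A\<close>) must see the other vertices of this kind and those of the middle kind (\<open>C\<close>),
  and a vertex seeing nothing (\<open>B\<close>) must see neither. The relation between \<open>A\<close> and \<open>B\<close> and
  within \<open>C\<close> is free. The first component is the row of the second vertex, so it is longer by
  one entry.
\<close>

definition new_pairs :: "code \<Rightarrow> (bool list \<times> bool list) list" where
  "new_pairs c = (let A = replicate (length c) True; B = replicate (length c) False; C = take 1 (splits c) in
     map (\<lambda>m. (False # A, m)) (A # C) @ map (\<lambda>m. (True # B, m)) (B # C))"

text \<open>
  If there were no such vertex or pair, the outer vertices would fall into three classes: \<open>A\<close>
  sees the list completely, \<open>B\<close> not at all, and \<open>C\<close> exactly in the clique side \<open>K\<close>. Then \<open>A\<close>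
  would be a clique complete to \<open>C\<close>, and \<open>B\<close> would be independent with no edges to \<open>C\<close>. This
  makes \<open>G\<close> decomposable: if \<open>C\<close> is nonempty, then \<open>vs\<close> with \<open>A\<close> and \<open>B\<close> composes with \<open>C\<close>; if
  it is empty, then \<open>A \<union> B\<close> composes with \<open>vs\<close>.
\<close>

lemma growth:
  assumes G: "is_graph G" and ind: "\<not> decomposable G"
    and vs: "distinct vs" "vs \<noteq> []" "set vs \<subset> verts G"
  shows "(\<exists>v\<in>verts G - set vs. map (adj G v) vs \<in> set (new_rows (code (adj G) vs))) \<or>
    (\<exists>u\<in>verts G - set vs. \<exists>v\<in>verts G - set vs. u \<noteq> v \<and>
       (map (adj G u) (v # vs), map (adj G v) vs) \<in> set (new_pairs (code (adj G) vs)))"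
proof (rule ccontr)
  assume contr: "\<not> ?thesis"
  let ?R = "verts G - set vs" and ?c = "code (adj G) vs"
  let ?row = "\<lambda>v. map (adj G v) vs"
  let ?C = "set (take 1 (splits ?c))"
  define A where "A = {v \<in> ?R. \<forall>w\<in>set vs. adj G v w}"
  define B where "B = {v \<in> ?R. \<forall>w\<in>set vs. \<not> adj G v w}"
  define C where "C = ?R - A - B"
  have rowA: "?row v = replicate (length vs) True \<longleftrightarrow> (\<forall>w\<in>set vs. adj G v w)" for v
    unfolding map_replicate_const[symmetric] map_eq_conv by simp
  have rowB: "?row v = replicate (length vs) False \<longleftrightarrow> (\<forall>w\<in>set vs. \<not> adj G v w)" for v
    unfolding map_replicate_const[symmetric] map_eq_conv by simp
  have typical: "?row v \<in> set (homogeneous_rows ?c)" if "v \<in> ?R" for v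
    using contr that by (auto simp: new_rows_def Let_def set_n_lists)
  have rowC: "?row v \<in> ?C" if "v \<in> C" for v
    using typical[of v] that rowA[of v] rowB[of v] by (auto simp: homogeneous_rows_def C_def A_def B_def)
  have pair: "\<not> (u \<noteq> v \<and> (map (adj G u) (v # vs), ?row v) \<in> set (new_pairs ?c))"
    if "u \<in> ?R" "v \<in> ?R" for u v
    using contr that by blast
  have A_to: "adj G u v" if "u \<in> A" "v \<in> A \<union> C" "u \<noteq> v" for u v
  proof (rule ccontr)
    assume "\<not> adj G u v"
    then have "(map (adj G u) (v # vs), ?row v) \<in> set (new_pairs ?c)"
      using that rowA[of u] rowA[of v] rowC[of v] by (auto simp: new_pairs_def Let_def A_def)
    then show False using pair[of u v] that by (auto simp: A_def C_def)
  qed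
  have B_to: "\<not> adj G u v" if "u \<in> B" "v \<in> B \<union> C" for u v
  proof
    assume a: "adj G u v"
    then have "(map (adj G u) (v # vs), ?row v) \<in> set (new_pairs ?c)"
      using that rowB[of u] rowB[of v] rowC[of v] by (auto simp: new_pairs_def Let_def B_def)
    then show False using pair[of u v] that a adj_irrefl[OF G] by (auto simp: B_def C_def)
  qed
  have A_W: "adj G u w" if "u \<in> A" "w \<in> set vs" for u w using that by (simp add: A_def)
  have B_W: "\<not> adj G u w" if "u \<in> B" "w \<in> set vs" for u w using that by (simp add: B_def)
  have R: "?R = A \<union> B \<union> C" by (auto simp: C_def A_def B_def)
  have AB: "A \<inter> B = {}" using vs(2) by (cases vs) (auto simp: A_def B_def)
  have "\<exists>S K T. tyshkevich_cut G S K T"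
  proof (cases "C = {}")
    case True
    \<comment> \<open>The listed vertices themselves are the lower factor.\<close>
    have "split_on (adj G) (A \<union> B) A"
      using A_to B_to AB by (auto simp: split_on_def)
    moreover have "adj G s t \<longleftrightarrow> s \<in> A" if "t \<in> set vs" "s \<in> A \<union> B" for s t
      using that AB by (auto simp: A_def B_def)
    ultimately have "tyshkevich_cut G (A \<union> B) A (set vs)"
      using True R vs(2,3) by (auto simp: tyshkevich_cut_def)
    then show ?thesis by blast
  next
    case False
    then have "splits ?c \<noteq> []" using rowC by fastforce
    then obtain m where m: "?C = {m}" "m \<in> set (splits ?c)"
      by (cases "splits ?c") auto
    obtain K where mK: "m = map (\<lambda>v. v \<in> K) vs" and K: "split_on (adj G) (set vs) K"
      using m(2) splits_code[of vs "adj G"] vs(1) adj_sym[of G] adj_irrefl[OF G] by metis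
    have C_to: "adj G w v \<longleftrightarrow> w \<in> K" if "v \<in> C" "w \<in> set vs" for v w
    proof -
      have "?row v = map (\<lambda>w. w \<in> K) vs"
        using rowC[OF that(1)] unfolding m(1) mK by blast
      then show ?thesis using that(2) adj_sym[of G v w] by auto
    qed
    have disj: "set vs \<inter> ?R = {}" by blast
    \<comment> \<open>Now the listed vertices belong to the upper factor, and \<open>K\<close> extends by \<open>A\<close>.\<close>
    have "split_on (adj G) (set vs \<union> A \<union> B) (K \<union> A)"
      unfolding split_on_def
    proof (intro conjI ballI impI)
      show "K \<union> A \<subseteq> set vs \<union> A \<union> B" using K by (auto simp: split_on_def)
    next
      fix u v assume uv: "u \<in> K \<union> A" "v \<in> K \<union> A" "u \<noteq> v"
      have KW: "K \<subseteq> set vs" using K by (auto simp: split_on_def)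
      have "adj G u v \<or> adj G v u"
      proof (cases "u \<in> A \<or> v \<in> A")
        case True then show ?thesis using uv KW A_to[of u v] A_to[of v u] A_W[of u v] A_W[of v u] by blast
      next
        case False then show ?thesis using uv K by (auto simp: split_on_def)
      qed
      then show "adj G u v" by (simp add: adj_sym)
    next
      fix u v assume uv: "u \<in> set vs \<union> A \<union> B - (K \<union> A)" "v \<in> set vs \<union> A \<union> B - (K \<union> A)"
      have "\<not> adj G u v \<or> \<not> adj G v u"
      proof (cases "u \<in> B \<or> v \<in> B")
        case True then show ?thesis using uv B_to[of u v] B_to[of v u] B_W[of u v] B_W[of v u] by blast
      next
        case False then show ?thesis using uv K by (auto simp: split_on_def)
      qed
      then show "\<not> adj G u v" by (simp add: adj_sym)
    qed
    moreover have "adj G s t \<longleftrightarrow> s \<in> K \<union> A" if st: "t \<in> C" "s \<in> set vs \<union> A \<union> B" for s t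
    proof -
      consider "s \<in> set vs" | "s \<in> A" | "s \<in> B" using st by blast
      then show ?thesis
      proof cases
        case 1 then show ?thesis using C_to st by (auto simp: A_def)
      next
        case 2 then show ?thesis using A_to[of s t] st by (auto simp: C_def)
      next
        case 3
        moreover have "s \<notin> K" using 3 K by (auto simp: B_def split_on_def)
        ultimately show ?thesis using B_to[of s t] st AB by auto
      qed
    qed
    moreover have "set vs \<union> A \<union> B \<union> C = verts G" using R vs(3) by blast
    moreover have "(set vs \<union> A \<union> B) \<inter> C = {}" unfolding C_def by blast
    ultimately have "tyshkevich_cut G (set vs \<union> A \<union> B) (K \<union> A) C"
      using False vs(2) by (auto simp: tyshkevich_cut_def)
    then show ?thesis by blast
  qed
  then show False using ind decomposable_iff[OF G] by blast
qed

section \<open>Recognising isomorphic graphs\<close>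

text \<open>
  A backtracking search for an order of the vertices \<open>xs\<close>, placed in front of \<open>ys\<close>, that gives
  the prescribed rows. The rows are taken from the oldest vertex on, since a row can be compared
  only when all older vertices are in place.
\<close>

fun orders_as :: "(nat \<Rightarrow> nat \<Rightarrow> bool) \<Rightarrow> nat list \<Rightarrow> nat list \<Rightarrow> code \<Rightarrow> bool" where
  "orders_as E xs ys [] = (xs = [])"
| "orders_as E xs ys (r # rs) = list_ex (\<lambda>x. map (E x) ys = r \<and> orders_as E (remove1 x xs) (x # ys) rs) xs"

lemma orders_as_iff:
  assumes "distinct xs"
  shows "orders_as E xs ys rs \<longleftrightarrow>
    (\<exists>zs. distinct zs \<and> set zs = set xs \<and> code E (zs @ ys) = rev rs @ code E ys)"
  using assms
proof (induction rs arbitrary: xs ys)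
  case Nil
  have "zs = []" if "code E (zs @ ys) = code E ys" for zs
    using arg_cong[OF that, of length] by simp
  then have "(\<exists>zs. distinct zs \<and> set zs = set xs \<and> code E (zs @ ys) = code E ys) \<longleftrightarrow> set xs = {}"
    by (metis append_Nil distinct.simps(1) set_empty)
  then show ?case by simp
next
  case (Cons r rs)
  show ?case
  proof
    assume "orders_as E xs ys (r # rs)"
    then obtain x where x: "x \<in> set xs" "map (E x) ys = r" "orders_as E (remove1 x xs) (x # ys) rs"
      unfolding orders_as.simps list_ex_iff by blast
    then obtain zs where zs: "distinct zs" "set zs = set (remove1 x xs)"
      "code E (zs @ x # ys) = rev rs @ code E (x # ys)"
      using Cons.IH[of "remove1 x xs" "x # ys"] Cons.prems by auto
    have "distinct (zs @ [x])" "set (zs @ [x]) = set xs"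
      "code E ((zs @ [x]) @ ys) = rev (r # rs) @ code E ys"
      using zs x Cons.prems by (auto simp: set_remove1_eq)
    then show "\<exists>zs. distinct zs \<and> set zs = set xs \<and> code E (zs @ ys) = rev (r # rs) @ code E ys"
      by blast
  next
    assume "\<exists>zs. distinct zs \<and> set zs = set xs \<and> code E (zs @ ys) = rev (r # rs) @ code E ys"
    then obtain zs where zs: "distinct zs" "set zs = set xs" "code E (zs @ ys) = rev (r # rs) @ code E ys"
      by blast
    \<comment> \<open>The vertex placed first is the one next to \<open>ys\<close>, hence the last of \<open>zs\<close>.\<close>
    have "zs \<noteq> []" using zs(3) by auto
    then obtain zs' x where zs': "zs = zs' @ [x]" by (metis rev_exhaust)
    obtain pre where pre: "code E (zs' @ x # ys) = pre @ code E (x # ys)"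
      using code_append by blast
    have "pre @ map (E x) ys # code E ys = rev rs @ r # code E ys"
      using pre zs(3) by (simp add: zs')
    then have "pre = rev rs \<and> map (E x) ys = r"
      by (simp add: append_eq_append_conv)
    then have *: "map (E x) ys = r" "code E (zs' @ x # ys) = rev rs @ code E (x # ys)"
      using pre by simp_all
    have "distinct zs'" "set zs' = set (remove1 x xs)" "x \<in> set xs"
      using zs(1,2) Cons.prems by (auto simp: zs' set_remove1_eq)
    then have "orders_as E (remove1 x xs) (x # ys) rs"
      using Cons.IH[of "remove1 x xs" "x # ys"] Cons.prems *(2) by auto
    then show "orders_as E xs ys (r # rs)"
      using \<open>x \<in> set xs\<close> *(1) unfolding orders_as.simps list_ex_iff by blast
  qed
qed

definition same_graph :: "code \<Rightarrow> code \<Rightarrow> bool" where "same_graph c d \<longleftrightarrow> length c = length d \<and> (let M = full False c in orders_as (\<lambda>i j. M ! i ! j) [0..<length c] [] (rev d))"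

text \<open>
  Positions in \<open>ws\<close> name the vertices of \<open>G\<close>, which lets the search run over numbers and list
  entries.
\<close>

lemma same_graph_iff:
  assumes G: "is_graph G" and ws: "distinct ws" "set ws = verts G"
  shows "same_graph (code (adj G) ws) d \<longleftrightarrow>
    (\<exists>us. distinct us \<and> set us = verts G \<and> code (adj G) us = d)"
proof -
  let ?n = "length ws" and ?E = "\<lambda>i j. full False (code (adj G) ws) ! i ! j"
  have E: "code ?E zs = code (adj G) (map ((!) ws) zs)" if "set zs \<subseteq> {..<?n}" for zs
    unfolding code_map using that
    by (intro code_cong) (auto simp: full_False_code[OF G ws(1)] subset_iff)
  have bij: "bij_betw ((!) ws) {..<?n} (verts G)"
    using bij_betw_nth[OF ws(1) refl] ws(2) by simp
  have "same_graph (code (adj G) ws) d \<longleftrightarrow> ?n = length d \<and>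
      (\<exists>zs. distinct zs \<and> set zs = {..<?n} \<and> code ?E zs = d)"
    unfolding same_graph_def Let_def by (simp add: orders_as_iff atLeast0LessThan)
  also have "\<dots> \<longleftrightarrow> (\<exists>zs. distinct zs \<and> set zs = {..<?n} \<and> code ?E zs = d)"
    using distinct_card by fastforce
  also have "\<dots> \<longleftrightarrow> (\<exists>us. distinct us \<and> set us = verts G \<and> code (adj G) us = d)"
  proof
    assume "\<exists>zs. distinct zs \<and> set zs = {..<?n} \<and> code ?E zs = d"
    then obtain zs where zs: "distinct zs" "set zs = {..<?n}" "code ?E zs = d" by blast
    then have "distinct (map ((!) ws) zs)" "set (map ((!) ws) zs) = verts G"
      using bij by (auto simp: distinct_map bij_betw_def)
    then show "\<exists>us. distinct us \<and> set us = verts G \<and> code (adj G) us = d"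
      using zs E[of zs] by (intro exI[of _ "map ((!) ws) zs"]) simp
  next
    assume "\<exists>us. distinct us \<and> set us = verts G \<and> code (adj G) us = d"
    then obtain us where us: "distinct us" "set us = verts G" "code (adj G) us = d" by blast
    let ?g = "inv_into {..<?n} ((!) ws)"
    have g: "bij_betw ?g (verts G) {..<?n}" by (rule bij_betw_inv_into[OF bij])
    have "map ((!) ws) (map ?g us) = us"
      using bij us(2) by (auto simp: bij_betw_def f_inv_into_f intro!: map_idI)
    moreover have "distinct (map ?g us)" "set (map ?g us) = {..<?n}"
      using g us by (auto simp: distinct_map bij_betw_def)
    ultimately show "\<exists>zs. distinct zs \<and> set zs = {..<?n} \<and> code ?E zs = d"
      using E[of "map ?g us"] us(3) by (intro exI[of _ "map ?g us"]) simp
  qed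
  finally show ?thesis .
qed

text \<open>
  An isomorphism carries an order of \<open>G\<close> to an order of \<open>H\<close> with the same code. Conversely,
  equal codes have equal square matrices, so that matching the vertices by position is an
  isomorphism.
\<close>

lemma isomorphic_iff_code:
  assumes G: "is_graph G" and H: "is_graph H" and us: "distinct us" "set us = verts G"
  shows "isomorphic G H \<longleftrightarrow>
    (\<exists>vs. distinct vs \<and> set vs = verts H \<and> code (adj H) vs = code (adj G) us)"
proof
  assume "isomorphic G H"
  then obtain f where f: "bij_betw f (verts G) (verts H)"
    "\<And>u v. u \<in> verts G \<Longrightarrow> v \<in> verts G \<Longrightarrow> adj G u v \<longleftrightarrow> adj H (f u) (f v)"
    by (auto simp: isomorphic_def adj_def)
  have "code (adj H) (map f us) = code (adj G) us"
    unfolding code_map using f(2) us(2) by (intro code_cong) auto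
  moreover have "distinct (map f us)" "set (map f us) = verts H"
    using f(1) us by (auto simp: distinct_map bij_betw_def)
  ultimately show "\<exists>vs. distinct vs \<and> set vs = verts H \<and> code (adj H) vs = code (adj G) us" by blast
next
  assume "\<exists>vs. distinct vs \<and> set vs = verts H \<and> code (adj H) vs = code (adj G) us"
  then obtain vs where vs: "distinct vs" "set vs = verts H" and c: "code (adj H) vs = code (adj G) us"
    by blast
  let ?n = "length us"
  have len: "length vs = ?n" using arg_cong[OF c, of length] by simp
  have m: "map (\<lambda>u. map (adj H u) vs) vs = map (\<lambda>u. map (adj G u) us) us"
    using full_False_code[OF G us(1)] full_False_code[OF H vs(1)] c by simp
  have E: "adj H (vs ! i) (vs ! j) = adj G (us ! i) (us ! j)" if "i < ?n" "j < ?n" for i j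
    using arg_cong[OF m, of "\<lambda>M. M ! i ! j"] that len by simp
  have bu: "bij_betw ((!) us) {..<?n} (verts G)" using bij_betw_nth[OF us(1) refl] us(2) by simp
  have bv: "bij_betw ((!) vs) {..<?n} (verts H)" using bij_betw_nth[OF vs(1)] vs(2) len by simp
  let ?g = "inv_into {..<?n} ((!) us)"
  have g: "bij_betw ?g (verts G) {..<?n}" by (rule bij_betw_inv_into[OF bu])
  have gu: "us ! ?g u = u" "?g u < ?n" if "u \<in> verts G" for u
    using that bu g by (auto simp: bij_betw_def f_inv_into_f)
  have "bij_betw ((!) vs \<circ> ?g) (verts G) (verts H)" by (rule bij_betw_trans[OF g bv])
  moreover have "adj G u v \<longleftrightarrow> adj H (((!) vs \<circ> ?g) u) (((!) vs \<circ> ?g) v)"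
    if "u \<in> verts G" "v \<in> verts G" for u v
    using E[of "?g u" "?g v"] gu[OF that(1)] gu[OF that(2)] by simp
  ultimately show "isomorphic G H" unfolding isomorphic_def adj_def by blast
qed

section \<open>The eighteen graphs\<close>

definition complete_code :: "nat \<Rightarrow> code" where "complete_code n = rev (map (\<lambda>i. replicate i True) [0..<n])"

definition complement_code :: "code \<Rightarrow> code" where "complement_code = map (map Not)"

text \<open>
  The graphs $D_{4,1}$, $D_{2,2}$, $R_{311}$, $R_{331}$, $R_{211}$, $R_{321}$, with the
  independent set in front of the clique, and $B_1$, $B_2$, $B_3$, with $v$ in front of the
  cycle.
\<close>

definition base_codes :: "code list" where "base_codes = (let F = False; T = True in [
 [[F,T,F,F,F,F],[F,T,T,T,T]] @ complete_code 5,
 [[F,T,T,F,F],[F,F,T,T]] @ complete_code 4,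
 [[F,F,T,F,F,F],[F,F,T,F,F],[T,F,T,T]] @ complete_code 4,
 [[F,F,T,F,F,F],[F,F,T,T,T],[T,F,T,T]] @ complete_code 4,
 [[F,F,T,F,F],[F,F,T,T],[T,F,F]] @ complete_code 3,
 [[F,F,T,F,F,F],[F,F,T,T,F],[T,F,T,T]] @ complete_code 4,
 [[T,F,F,F],[T,F,T],[T,F],[T],[]],
 [[T,T,F,F],[T,F,T],[T,F],[T],[]],
 [[T,T,T,F],[T,F,T],[T,F],[T],[]]])"

definition atlas :: "code list" where "atlas = concat (map (\<lambda>c. [c, complement_code c]) base_codes)"

definition has_code :: "'a graph \<Rightarrow> code \<Rightarrow> bool" where
  "has_code G c \<longleftrightarrow> is_graph G \<and> (\<exists>ws. distinct ws \<and> set ws = verts G \<and> code (adj G) ws = c)"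

lemma adj_complement:
  "adj (complement G) u v \<longleftrightarrow> u \<in> verts G \<and> v \<in> verts G \<and> u \<noteq> v \<and> \<not> adj G u v"
  by (auto simp: adj_def complement_def doubleton_eq_iff insert_commute)

lemma has_code_complement:
  assumes "has_code G c"
  shows "has_code (complement G) (complement_code c)"
proof -
  obtain ws where G: "is_graph G" and ws: "distinct ws" "set ws = verts G" "code (adj G) ws = c"
    using assms by (auto simp: has_code_def)
  have "is_graph (complement G)"
    using G by (auto simp: is_graph_def complement_def card_insert_if)
  moreover have "code (adj (complement G)) us = complement_code (code (adj G) us)"
    if "distinct us" "set us \<subseteq> verts G" for us
    using that by (induction us) (auto simp: complement_code_def adj_complement)
  then have "code (adj (complement G)) ws = complement_code c" using ws by auto
  moreover have "set ws = verts (complement G)" using ws by (simp add: complement_def)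
  ultimately show ?thesis using ws(1) unfolding has_code_def by blast
qed

lemma adj_split_of:
  "adj (split_of K I N) u v \<longleftrightarrow> u \<in> K \<and> v \<in> K \<and> u \<noteq> v \<or> u \<in> I \<and> v \<in> N u \<or> v \<in> I \<and> u \<in> N v"
  by (auto simp: adj_def split_of_def doubleton_eq_iff)

lemma adj_Bj:
  "adj (Bj j) u v \<longleftrightarrow> {u, v} \<in> {{0, 1}, {1, 2}, {2, 3}, {3, 0}} \<or> u = 4 \<and> v < j \<or> v = 4 \<and> u < j"
  by (auto simp: adj_def Bj_def doubleton_eq_iff)

lemma has_code_split_of:
  assumes "finite K" "finite I" "K \<noteq> {}" "K \<inter> I = {}" "\<And>i. i \<in> I \<Longrightarrow> N i \<subseteq> K"
    "distinct ws" "set ws = K \<union> I" "code (adj (split_of K I N)) ws = c"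
  shows "has_code (split_of K I N) c"
proof -
  have "is_graph (split_of K I N)"
    using assms(1-5) by (fastforce simp: is_graph_def split_of_def card_insert_if)
  then show ?thesis using assms(6-8) unfolding has_code_def by (auto simp: split_of_def)
qed

lemma has_code_Bj:
  assumes "j \<le> 4" "code (adj (Bj j)) [4, 0, 1, 2, 3] = c"
  shows "has_code (Bj j) c"
proof -
  have "is_graph (Bj j)"
    using assms(1) by (auto simp: is_graph_def Bj_def card_insert_if)
  then show ?thesis using assms(2) unfolding has_code_def
    by (intro conjI exI[of _ "[4, 0, 1, 2, 3]"]) (auto simp: Bj_def)
qed

lemmas code_simps = base_codes_def complete_code_def Let_def adj_split_of adj_Bj doubleton_eq_iff

lemma has_code_base_codes:
  "list_all2 has_code [D41, D22, R311, R331, R211, R321, Bj 1, Bj 2, Bj 3] base_codes"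
proof -
  have "has_code D41 (base_codes ! 0)" unfolding D41_def
    by (rule has_code_split_of[where ws = "[6, 7, 1, 2, 3, 4, 5]"]) (auto simp: code_simps upt_rec)
  moreover have "has_code D22 (base_codes ! 1)" unfolding D22_def
    by (rule has_code_split_of[where ws = "[6, 7, 1, 2, 3, 4]"]) (auto simp: code_simps upt_rec)
  moreover have "has_code R311 (base_codes ! 2)" unfolding R311_def
    by (rule has_code_split_of[where ws = "[6, 7, 8, 1, 2, 3, 4]"]) (auto simp: code_simps upt_rec)
  moreover have "has_code R331 (base_codes ! 3)" unfolding R331_def
    by (rule has_code_split_of[where ws = "[6, 7, 8, 1, 2, 3, 4]"]) (auto simp: code_simps upt_rec)
  moreover have "has_code R211 (base_codes ! 4)" unfolding R211_def
    by (rule has_code_split_of[where ws = "[6, 7, 8, 1, 2, 3]"]) (auto simp: code_simps upt_rec)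
  moreover have "has_code R321 (base_codes ! 5)" unfolding R321_def
    by (rule has_code_split_of[where ws = "[6, 7, 8, 1, 2, 3, 4]"]) (auto simp: code_simps upt_rec)
  moreover have "has_code (Bj 1) (base_codes ! 6)" "has_code (Bj 2) (base_codes ! 7)" "has_code (Bj 3) (base_codes ! 8)"
    by (rule has_code_Bj; simp add: code_simps)+
  ultimately show ?thesis by (simp add: base_codes_def Let_def)
qed

lemma has_code_atlas:
  "list_all2 has_code (split_list @ nonsplit_list) atlas"
proof -
  have "list_all2 has_code (concat (map (\<lambda>G. [G, complement G]) Gs)) (concat (map (\<lambda>c. [c, complement_code c]) cs))"
    if "list_all2 has_code Gs cs" for Gs cs
    using that by (induction rule: list_all2_induct) (auto intro: has_code_complement)
  from this[OF has_code_base_codes] show ?thesis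
    by (simp add: atlas_def split_list_def nonsplit_list_def)
qed

lemma not_isomorphic:
  assumes "has_code G c" "has_code H d" "\<not> same_graph d c"
  shows "\<not> isomorphic G H"
  using assms same_graph_iff isomorphic_iff_code unfolding has_code_def by metis

section \<open>Primality\<close>

text \<open>
  Requiring \<open>a\<close> to be the smallest of the four indices selects one of the four presentations of
  each 2-switch.
\<close>

definition switch_quads :: "code \<Rightarrow> (nat \<times> nat \<times> nat \<times> nat) list" where
  "switch_quads c = (let M = full False c; is = [0..<length c] in
     [(a, b, x, y). a \<leftarrow> is, b \<leftarrow> filter (\<lambda>b. M ! a ! b) is,
        x \<leftarrow> filter (\<lambda>x. x \<noteq> a \<and> \<not> M ! a ! x) is,
        y \<leftarrow> filter (\<lambda>y. y \<noteq> b \<and> M ! x ! y \<and> \<not> M ! b ! y) is, a < b \<and> a < x \<and> a < y])"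

text \<open>
  Connectedness of the hypergraph formed by the vertex sets of the 2-switches, tested on all
  colourings of the vertices with two colours.
\<close>

definition linked :: "code \<Rightarrow> bool" where
  "linked c \<longleftrightarrow> (let qs = switch_quads c in
     list_all (\<lambda>m. list_all id m \<or> \<not> list_ex id m \<or>
       list_ex (\<lambda>(a, b, x, y). \<not> (m ! a = m ! b \<and> m ! a = m ! x \<and> m ! a = m ! y)) qs)
     (List.n_lists (length c) [False, True]))"

lemma switch_quads_switchable:
  assumes G: "is_graph G" and ws: "distinct ws" "set ws = verts G"
    and q: "(a, b, x, y) \<in> set (switch_quads (code (adj G) ws))"
  shows "switchable G (ws ! a) (ws ! b) (ws ! x) (ws ! y) \<and>
    a < length ws \<and> b < length ws \<and> x < length ws \<and> y < length ws"
proof -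
  let ?M = "full False (code (adj G) ws)"
  have M: "?M ! i ! j = adj G (ws ! i) (ws ! j)" if "i < length ws" "j < length ws" for i j
    using that by (simp add: full_False_code[OF G ws(1)])
  have lt: "a < length ws" "b < length ws" "x < length ws" "y < length ws" and
    e: "?M ! a ! b" "\<not> ?M ! a ! x" "?M ! x ! y" "\<not> ?M ! b ! y" and ne: "a < b" "a < x" "a < y" "y \<noteq> b"
    using q by (auto simp: switch_quads_def Let_def split: if_splits)
  have adj: "adj G (ws ! a) (ws ! b)" "\<not> adj G (ws ! a) (ws ! x)" "adj G (ws ! x) (ws ! y)"
    "\<not> adj G (ws ! b) (ws ! y)"
    using e lt by (simp_all add: M)
  have "x \<noteq> y" using adj(3) adj_irrefl[OF G] by auto
  moreover have "x \<noteq> b" using adj(1,2) by auto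
  ultimately have "distinct [ws ! a, ws ! b, ws ! x, ws ! y]"
    using lt ne ws(1) by (simp add: nth_eq_iff_index_eq)
  moreover have "{ws ! a, ws ! b, ws ! x, ws ! y} \<subseteq> verts G"
    using lt ws(2) by (auto dest: nth_mem)
  ultimately show ?thesis using adj lt by (simp add: switchable_def adj_def)
qed

lemma linkedD:
  assumes G: "is_graph G" and ws: "distinct ws" "set ws = verts G" and l: "linked (code (adj G) ws)"
    and p: "u \<in> verts G" "P u" "v \<in> verts G" "\<not> P v"
  shows "\<exists>a b x y. switchable G a b x y \<and> \<not> (P a = P b \<and> P a = P x \<and> P a = P y)"
proof -
  let ?m = "map P ws"
  have "?m \<in> set (List.n_lists (length ws) [False, True])"
    by (auto simp: set_n_lists)
  moreover have "\<not> list_all id ?m" "list_ex id ?m"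
    using p ws(2) by (auto simp: list_all_iff list_ex_iff)
  ultimately obtain a b x y where q: "(a, b, x, y) \<in> set (switch_quads (code (adj G) ws))"
    "\<not> (?m ! a = ?m ! b \<and> ?m ! a = ?m ! x \<and> ?m ! a = ?m ! y)"
    using l unfolding linked_def Let_def length_code list_all_iff list_ex_iff by fast
  then show ?thesis
    using switch_quads_switchable[OF G ws q(1)] by (metis nth_map)
qed

text \<open>
  On an alternating 4-cycle every vertex has one neighbour and one nonneighbour in cyclic order.
  If it met both parts, a crossing edge would end in \<open>K\<close> and a crossing nonedge in \<open>S - K\<close>, and
  following the cycle from there produces a nonedge inside \<open>K\<close>, an edge inside \<open>S - K\<close>, or a
  wrong pair between the parts.
\<close>

lemma cut_not_crossed:
  assumes cut: "tyshkevich_cut G S K T" and sw: "switchable G a b x y"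
  shows "(a \<in> S) = (b \<in> S) \<and> (a \<in> S) = (x \<in> S) \<and> (a \<in> S) = (y \<in> S)"
proof -
  have V: "v \<in> S \<or> v \<in> T" if "v \<in> {a, b, x, y}" for v
    using sw cut that by (auto simp: switchable_def tyshkevich_cut_def)
  have d: "S \<inter> T = {}" "K \<subseteq> S" using cut by (auto simp: tyshkevich_cut_def split_on_def)
  have ST: "s \<in> S \<Longrightarrow> t \<in> T \<Longrightarrow> (adj G s t \<longleftrightarrow> s \<in> K) \<and> (adj G t s \<longleftrightarrow> s \<in> K)" for s t
    using cut adj_sym[of G s t] by (simp add: tyshkevich_cut_def)
  have K: "u \<in> K \<Longrightarrow> v \<in> K \<Longrightarrow> u \<noteq> v \<Longrightarrow> adj G u v" for u v
    using cut by (simp add: tyshkevich_cut_def split_on_def)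
  have I: "u \<in> S - K \<Longrightarrow> v \<in> S - K \<Longrightarrow> \<not> adj G u v" for u v
    using cut by (simp add: tyshkevich_cut_def split_on_def)
  have e: "adj G a b" "adj G x y" "\<not> adj G a x" "\<not> adj G b y" "distinct [a, b, x, y]"
    using sw by (simp_all add: switchable_def adj_def)
  have e': "adj G b a" "adj G y x" "\<not> adj G x a" "\<not> adj G y b"
    using e adj_sym[of G] by blast+
  show ?thesis
    using V[of a] V[of b] V[of x] V[of y] e e' d
      ST[of a b] ST[of b a] ST[of a x] ST[of x a] ST[of b y] ST[of y b] ST[of x y] ST[of y x]
      K[of a x] K[of b y] I[of a b] I[of x y] by auto
qed

text \<open>
  Colouring the parts of a composition contradicts \<open>cut_not_crossed\<close>; colouring a single vertex
  shows that it lies on a 2-switch.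
\<close>

lemma prime_if_linked:
  assumes G: "is_graph G" and ws: "distinct ws" "set ws = verts G" "2 \<le> length ws"
    and l: "linked (code (adj G) ws)"
  shows "prime_graph G"
  unfolding prime_graph_def
proof
  show "\<not> decomposable G"
  proof
    assume "decomposable G"
    then obtain S K T where cut: "tyshkevich_cut G S K T" using decomposable_iff[OF G] by blast
    then obtain u v where uv: "u \<in> verts G" "u \<in> S" "v \<in> verts G" "v \<notin> S"
      by (auto simp: tyshkevich_cut_def)
    then obtain a b x y where "switchable G a b x y"
      "\<not> ((a \<in> S) = (b \<in> S) \<and> (a \<in> S) = (x \<in> S) \<and> (a \<in> S) = (y \<in> S))"
      using linkedD[OF G ws(1,2) l, of u "\<lambda>v. v \<in> S" v] by auto
    then show False using cut_not_crossed[OF cut] by blast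
  qed
  show "active G"
    unfolding active_def
  proof
    fix v assume v: "v \<in> verts G"
    have "card (verts G) \<noteq> 1" using ws distinct_card[OF ws(1)] by auto
    then obtain u where u: "u \<in> verts G" "u \<noteq> v" using v
      by (metis card_1_singleton_iff is_singletonI' is_singleton_def empty_iff One_nat_def)
    then obtain a b x y where "switchable G a b x y"
      "\<not> ((a = v) = (b = v) \<and> (a = v) = (x = v) \<and> (a = v) = (y = v))"
      using linkedD[OF G ws(1,2) l, of v "\<lambda>w. w = v" u] v by auto
    then show "active_vertex G v" unfolding active_vertex_def by blast
  qed
qed

lemma atlas_prime_deg: "list_all (\<lambda>c. 2 \<le> length c \<and> linked c \<and> deg c = 4) atlas"
  by code_simp

lemma atlas_split:
  "list_all (\<lambda>c. splits c \<noteq> []) (take 12 atlas)"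
  "list_all (\<lambda>c. splits c = []) (drop 12 atlas)"
  by code_simp+

lemma atlas_distinct: "sorted_wrt (\<lambda>c d. \<not> same_graph c d \<and> \<not> same_graph d c) atlas"
  by code_simp

section \<open>The search\<close>

definition size_code :: "code \<Rightarrow> nat" where "size_code c = length (filter id (concat c))"

text \<open>
  The comparison of the numbers of vertices and edges only saves time: among the eighteen graphs
  they leave no more than two candidates, since only $B_1$ and its complement share both.
\<close>

definition recognised :: "code \<Rightarrow> bool" where
  "recognised c \<longleftrightarrow> list_ex (\<lambda>a. if length a = length c \<and> size_code a = size_code c then same_graph a c else False) atlas"

text \<open>
  The argument \<open>d\<close> is the degree of \<open>c\<close>. Nodes of degree above 4 need no further inspection as
  the degree of an induced subgraph is at most that of the graph; \<open>n\<close> bounds the depth.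
\<close>

fun explore :: "nat \<Rightarrow> nat \<Rightarrow> code \<Rightarrow> bool" where
  "explore 0 d c = False"
| "explore (Suc n) d c = (if d > 4 then True else if d = 4 then recognised c else
     (let t = completions c in
      list_all (\<lambda>r. explore n (d + gain r t) (r # c)) (new_rows c) \<and>
      list_all (\<lambda>(s, r). explore n (d + gain r t + gain s (completions (r # c))) (s # r # c)) (new_pairs c)))"

text \<open>
  Below degree 4 the list cannot span \<open>G\<close>, and \<open>growth\<close> leads to one of the children of the
  node.
\<close>

lemma explore_sound:
  assumes G: "is_graph G" "\<not> decomposable G" "active G" "switch_degree G = 4"
    and vs: "distinct vs" "vs \<noteq> []" "set vs \<subseteq> verts G"
    and "explore n (deg (code (adj G) vs)) (code (adj G) vs)"
  shows "\<exists>ws. distinct ws \<and> set ws = verts G \<and> recognised (code (adj G) ws)"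
  using vs assms(8)
proof (induction n arbitrary: vs)
  case 0
  then show ?case by simp
next
  case (Suc n)
  let ?c = "code (adj G) vs"
  note vs = Suc.prems(1-3)
  have le: "deg ?c \<le> 4" using deg_code_le[OF G(1) vs(1,3)] G(4) by simp
  show ?case
  proof (cases "deg ?c = 4")
    case True
    then have "set vs = verts G" using spanning_if_all_switches_inside[OF G(1,3) vs(1,3)] G(4) by simp
    moreover have "recognised ?c" using Suc.prems(4) True by simp
    ultimately show ?thesis using vs(1) by blast
  next
    case False
    then have "set vs \<noteq> verts G"
      using switch_degree_code[OF G(1) vs(1)] G(4) by auto
    then have sub: "set vs \<subset> verts G" using vs(3) by blast
    have expl: "list_all (\<lambda>r. explore n (deg (r # ?c)) (r # ?c)) (new_rows ?c)"
      "list_all (\<lambda>(s, r). explore n (deg (s # r # ?c)) (s # r # ?c)) (new_pairs ?c)"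
      using Suc.prems(4) False le by (simp_all add: Let_def add_ac)
    from growth[OF G(1,2) vs(1,2) sub] show ?thesis
    proof (elim disjE bexE conjE)
      fix v assume v: "v \<in> verts G - set vs" "map (adj G v) vs \<in> set (new_rows ?c)"
      then have "explore n (deg (code (adj G) (v # vs))) (code (adj G) (v # vs))"
        using expl(1) by (simp add: list_all_iff)
      then show ?thesis using Suc.IH[of "v # vs"] v vs by simp
    next
      fix u v assume uv: "u \<in> verts G - set vs" "v \<in> verts G - set vs" "u \<noteq> v"
        "(map (adj G u) (v # vs), map (adj G v) vs) \<in> set (new_pairs ?c)"
      then have "explore n (deg (code (adj G) (u # v # vs))) (code (adj G) (u # v # vs))"
        using expl(2) by (fastforce simp add: list_all_iff)
      then show ?thesis using Suc.IH[of "u # v # vs"] uv vs by simp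
    qed
  qed
qed

text \<open>
  An alternating 4-cycle \<open>a b y x\<close>, with its diagonals \<open>a y\<close> and \<open>b x\<close> left open.
\<close>

definition start_code :: "bool \<Rightarrow> bool \<Rightarrow> code" where
  "start_code p q = [[True, False, p], [q, False], [True], []]"

text \<open>
  The presentation of the same 2-switch that swaps \<open>a\<close> with \<open>b\<close> and \<open>x\<close> with \<open>y\<close> interchanges
  the diagonals.
\<close>

lemma start_code_exists:
  assumes G: "is_graph G" and d: "switch_degree G \<noteq> 0"
  shows "\<exists>vs p q. distinct vs \<and> set vs \<subseteq> verts G \<and> code (adj G) vs = start_code p q \<and> (q \<longrightarrow> p)"
proof -
  have "two_switches G \<noteq> {}" using d by (auto simp: switch_degree_def)
  then obtain a b x y where sw: "switchable G a b x y"
    by (auto simp: two_switches_def)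
  have c: "distinct [a, b, x, y] \<and> set [a, b, x, y] \<subseteq> verts G \<and>
      code (adj G) [a, b, x, y] = start_code (adj G a y) (adj G b x)" if "switchable G a b x y" for a b x y
    using that by (auto simp: switchable_def adj_def start_code_def)
  show ?thesis
  proof (cases "adj G b x \<longrightarrow> adj G a y")
    case True
    then show ?thesis using c[OF sw] by blast
  next
    case False
    then show ?thesis using c[OF switchable_sym(1)[OF sw]] by blast
  qed
qed

text \<open>
  The roots are $C_4$, $2K_2$ and $P_4$. The depth 4 admits three successive enlargements.
\<close>

lemma explore_start:
  "explore 4 (deg (start_code True True)) (start_code True True)"
  "explore 4 (deg (start_code False False)) (start_code False False)"
  "explore 4 (deg (start_code True False)) (start_code True False)"
  by code_simp+

lemma recognised_isomorphic:
  assumes G: "is_graph G" and ws: "distinct ws" "set ws = verts G" and r: "recognised (code (adj G) ws)"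
  shows "\<exists>H\<in>set (split_list @ nonsplit_list). isomorphic G H"
proof -
  obtain c where c: "c \<in> set atlas" "same_graph c (code (adj G) ws)"
    using r by (auto simp: recognised_def list_ex_iff split: if_splits)
  then obtain H where H: "H \<in> set (split_list @ nonsplit_list)" "has_code H c"
    using has_code_atlas by (metis list_all2_conv_all_nth in_set_conv_nth)
  then obtain us where us: "is_graph H" "distinct us" "set us = verts H" "code (adj H) us = c"
    by (auto simp: has_code_def)
  have "isomorphic G H"
    using same_graph_iff[OF us(1-3)] isomorphic_iff_code[OF G us(1) ws] c(2) us(4) by simp
  then show ?thesis using H(1) by blast
qed

lemma classification:
  assumes G: "is_graph G" and p: "prime_graph G" and d: "switch_degree G = 4"
  shows "\<exists>H\<in>set (split_list @ nonsplit_list). isomorphic G H"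
proof -
  have pr: "\<not> decomposable G" "active G" using p by (simp_all add: prime_graph_def)
  have "switch_degree G \<noteq> 0" using d by simp
  then obtain vs p q where vs: "distinct vs" "set vs \<subseteq> verts G" "code (adj G) vs = start_code p q" "q \<longrightarrow> p"
    using start_code_exists[OF G] by metis
  have "vs \<noteq> []" using vs(3) by (auto simp: start_code_def)
  moreover have "explore 4 (deg (code (adj G) vs)) (code (adj G) vs)"
    using explore_start vs(3,4) by (cases p; cases q) auto
  ultimately obtain ws where "distinct ws" "set ws = verts G" "recognised (code (adj G) ws)"
    using explore_sound[OF G pr d vs(1)] vs(2) by blast
  then show ?thesis by (rule recognised_isomorphic[OF G])
qed

theorem corollary6p2:
  "length (split_list @ nonsplit_list) = 18 \<and>
   (\<forall>i<18. \<forall>j<18. i \<noteq> j \<longrightarrow>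
      \<not> isomorphic ((split_list @ nonsplit_list) ! i) ((split_list @ nonsplit_list) ! j)) \<and>
   (\<forall>H\<in>set (split_list @ nonsplit_list).
      is_graph H \<and> prime_graph H \<and> switch_degree H = 4) \<and>
   (\<forall>H\<in>set split_list. split_graph H) \<and>
   (\<forall>H\<in>set nonsplit_list. \<not> split_graph H) \<and>
   (\<forall>G :: 'a graph. is_graph G \<and> prime_graph G \<and> switch_degree G = 4 \<longrightarrow>
      (\<exists>H\<in>set (split_list @ nonsplit_list). isomorphic G H))"
proof (intro conjI)
  let ?L = "split_list @ nonsplit_list"
  show len: "length ?L = 18" by (simp add: split_list_def nonsplit_list_def)
  then have la: "length atlas = 18" using list_all2_lengthD[OF has_code_atlas] by simp
  have l12: "length split_list = 12" by (simp add: split_list_def)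
  have nth: "has_code (?L ! i) (atlas ! i)" if "i < 18" for i
    using list_all2_nthD[OF has_code_atlas] that len by simp
  have pairs: "\<not> same_graph (atlas ! i) (atlas ! j) \<and> \<not> same_graph (atlas ! j) (atlas ! i)" if "i < j" "j < 18" for i j
    using atlas_distinct that la by (simp add: sorted_wrt_iff_nth_less)
  show "\<forall>i<18. \<forall>j<18. i \<noteq> j \<longrightarrow> \<not> isomorphic (?L ! i) (?L ! j)"
  proof (intro allI impI)
    fix i j :: nat assume ij: "i < 18" "j < 18" "i \<noteq> j"
    have "\<not> same_graph (atlas ! j) (atlas ! i)"
      using pairs[of i j] pairs[of j i] ij by (cases "i < j") auto
    then show "\<not> isomorphic (?L ! i) (?L ! j)" by (rule not_isomorphic[OF nth[OF ij(1)] nth[OF ij(2)]])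
  qed
  have ex: "\<exists>i<18. H = ?L ! i" if "H \<in> set ?L" for H
    using that len by (metis in_set_conv_nth)
  show "\<forall>H\<in>set ?L. is_graph H \<and> prime_graph H \<and> switch_degree H = 4"
  proof
    fix H assume "H \<in> set ?L"
    then obtain i where i: "i < 18" "H = ?L ! i" using ex by blast
    have c: "2 \<le> length (atlas ! i)" "linked (atlas ! i)" "deg (atlas ! i) = 4"
      using atlas_prime_deg i(1) la by (simp_all add: list_all_length)
    obtain ws where ws: "is_graph H" "distinct ws" "set ws = verts H" "code (adj H) ws = atlas ! i"
      using nth[OF i(1)] i(2) by (auto simp: has_code_def)
    have "2 \<le> length ws" using c(1) by (simp flip: ws(4))
    then show "is_graph H \<and> prime_graph H \<and> switch_degree H = 4"
      using prime_if_linked[OF ws(1-3)] switch_degree_code[OF ws(1-3)] c ws by simp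
  qed
  have split: "split_graph (?L ! i) \<longleftrightarrow> splits (atlas ! i) \<noteq> []" if "i < 18" for i
    using nth[OF that] split_graph_code unfolding has_code_def by metis
  show "\<forall>H\<in>set split_list. split_graph H"
  proof
    fix H assume "H \<in> set split_list"
    then obtain i where i: "i < 12" "H = ?L ! i" using l12 by (metis in_set_conv_nth nth_append)
    have "splits (atlas ! i) \<noteq> []" using atlas_split(1) i(1) la by (simp add: list_all_length)
    then show "split_graph H" using split[of i] i by simp
  qed
  show "\<forall>H\<in>set nonsplit_list. \<not> split_graph H"
  proof
    fix H assume "H \<in> set nonsplit_list"
    moreover have "length nonsplit_list = 6" by (simp add: nonsplit_list_def)
    ultimately obtain k where k: "k < 6" "H = nonsplit_list ! k" by (metis in_set_conv_nth)
    have "H = ?L ! (12 + k)" using k l12 by (simp add: nth_append)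
    moreover have "splits (atlas ! (12 + k)) = []"
      using atlas_split(2) k(1) la by (simp add: list_all_length)
    ultimately show "\<not> split_graph H" using split[of "12 + k"] k(1) by simp
  qed
  show "\<forall>G :: 'a graph. is_graph G \<and> prime_graph G \<and> switch_degree G = 4 \<longrightarrow>
      (\<exists>H\<in>set ?L. isomorphic G H)"
    using classification by blast
qed

end
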